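(* Let $\tau\in\{\tau_1,\gamma,\lambda,\rho\}$. Then: (i) $\mathtt u\in\mathfrak A^*/\tau$ is an idempotent of $\mathfrak A^*/\tau$ if and only if $r_\tau(\mathtt u)=1$ or $r_\tau(\mathtt u)=x^+$ for some $x\in\mathfrak A$; (ii) the relation $\le_\tau$ is an order on $\mathfrak A^*/\tau$, thus $\mathfrak A^*/\tau$ is a $J$-trivial monoid; (iii) if $\mathtt W\subset\mathfrak A^*/\tau$ is a finite set of $\tau$-words (elements of $\mathfrak A^*/\tau$), then $M_\tau(\mathtt W)$ is a finite $J$-trivial monoid.
   Context: Let $\mathfrak A$ be a countably infinite alphabet and $\mathfrak A^*$ the free monoid over it, with empty word $1$. A letter is multiple in a word if it occurs at least twice in it; $\operatorname{mul}(\mathbf u)$ is the set of multiple letters of $\mathbf u$. Let $\tau_1$ be the congruence on $\mathfrak A^*$ generated by $a=a^2$, $a\in\mathfrak A$. For $\mathbf u,\mathbf v\in\mathfrak A^*$: $\mathbf u\,\gamma\,\mathbf v$ iff $\mathbf u\,\tau_1\,\mathbf v$ and $\operatorname{mul}(\mathbf u)=\operatorname{mul}(\mathbf v)$; $\mathbf u\,\lambda\,\mathbf v$ (resp. $\mathbf u\,\rho\,\mathbf v$) iff $\mathbf u\,\gamma\,\mathbf v$ and, for each multiple letter, its first (resp. last) two occurrences are adjacent in $\mathbf u$ iff they are adjacent in $\mathbf v$. Canonical forms: let $\mathfrak B=\{a^+\mid a\in\mathfrak A\}$ be a formal alphabet of new symbols, disjoint from $\mathfrak A$. Consider the following rewriting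 rules on words $\mathbf u\in(\mathfrak A\cup\mathfrak B)^*$, for each $a\in\mathfrak A$: $R^{\tau_1}_{a\to a^+}$ replaces an occurrence of $a$ in $\mathbf u$ by $a^+$; $R^{\gamma}_{a\to a^+}$ replaces an occurrence of $a$ in $\mathbf u$ by $a^+$ only if $\mathbf u$ contains either another occurrence of $a$ or an occurrence of $a^+$; $R^{\lambda}_{a\to a^+}$ (resp. $R^{\rho}_{a\to a^+}$) replaces an occurrence of $a$ in $\mathbf u$ by $a^+$ only if $a$ or $a^+$ appears in $\mathbf u$ to the left (resp. right) of this occurrence of $a$; $R_{a^+a^+\to a^+}$, $R_{aa^+\to a^+}$, $R_{a^+a\to a^+}$ replace a factor $a^+a^+$, $aa^+$, $a^+a$, respectively, by $a^+$. For $\tau\in\{\tau_1,\gamma,\lambda,\rho\}$, every word $\mathbf u$ can be transformed by the rules $R^\tau_{a\to a^+},R_{a^+a^+\to a^+},R_{aa^+\to a^+},R_{a^+a\to a^+}$ ($a\in\mathfrak A$), in any order, to a unique word $r_\tau(\mathbf u)$ to which none of these rules is applicable; moreover for $\mathbf u,\mathbf v\in\mathfrak A^*$ one has $\mathbf u\,\tau\,\mathbf v$ iff $r_\tau(\mathbf u)=r_\tau(\mathbf v)$. For $\mathtt u\in\mathfrak A^*/\tau$ put $r_\tau(\mathtt u)=r_\tau(\mathbf u)$ for any $\mathbf u\in\mathtt u$. For $\mathtt u,\mathtt v\in\mathfrak A^*/\tau$ write $\mathtt v\le_\tau\mathtt u$ if $\mathtt u=\mathtt p\,\mathtt v\,\mathtt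 s$ in $\mathfrak A^*/\tau$ for some $\mathtt p,\mathtt s\in\mathfrak A^*/\tau$. For $\mathtt W\subseteq\mathfrak A^*/\tau$ let $\mathtt W^{\le_\tau}=\{\mathtt v\mid\mathtt v\le_\tau\mathtt u\text{ for some }\mathtt u\in\mathtt W\}$, and let $M_\tau(\mathtt W)$ be the Rees quotient of $\mathfrak A^*/\tau$ over the ideal $(\mathfrak A^*/\tau)\setminus\mathtt W^{\le_\tau}$, i.e. the monoid $\mathtt W^{\le_\tau}\cup\{0\}$ in which the product of $\mathtt u,\mathtt v\in\mathtt W^{\le_\tau}$ is their product in $\mathfrak A^*/\tau$ if that lies in $\mathtt W^{\le_\tau}$, and all other products are $0$. A monoid is $J$-trivial if Green's relation $\mathscr J$ on it is trivial. *)

theory Defs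
  imports "HOL-Algebra.Group" "HOL-Library.Countable_Set"
begin

definition mul :: "'a list \<Rightarrow> 'a set" where
  "mul u = {a. 2 \<le> count_list u a}"

inductive tau1 :: "'a list \<Rightarrow> 'a list \<Rightarrow> bool" where
  base: "tau1 [a] [a, a]"
| refl: "tau1 u u"
| sym: "tau1 u v \<Longrightarrow> tau1 v u"
| trans: "tau1 u v \<Longrightarrow> tau1 v w \<Longrightarrow> tau1 u w"
| cong: "tau1 u v \<Longrightarrow> tau1 u' v' \<Longrightarrow> tau1 (u @ u') (v @ v')"

definition gam :: "'a list \<Rightarrow> 'a list \<Rightarrow> bool" where
  "gam u v \<longleftrightarrow> tau1 u v \<and> mul u = mul v"

definition first_two_adjacent :: "'a \<Rightarrow> 'a list \<Rightarrow> bool" where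
  "first_two_adjacent a u \<longleftrightarrow> (\<exists>p s. u = p @ [a, a] @ s \<and> a \<notin> set p)"

definition last_two_adjacent :: "'a \<Rightarrow> 'a list \<Rightarrow> bool" where
  "last_two_adjacent a u \<longleftrightarrow> (\<exists>p s. u = p @ [a, a] @ s \<and> a \<notin> set s)"

text \<open>In the next two definitions \<open>gam u v\<close> gives \<open>mul u = mul v\<close>, so it does not matter
  which of the two words the multiple letters are taken from.\<close>

definition lam :: "'a list \<Rightarrow> 'a list \<Rightarrow> bool" where
  "lam u v \<longleftrightarrow> gam u v \<and> (\<forall>a \<in> mul u. first_two_adjacent a u \<longleftrightarrow> first_two_adjacent a v)"

definition rho :: "'a list \<Rightarrow> 'a list \<Rightarrow> bool" where
  "rho u v \<longleftrightarrow> gam u v \<and> (\<forall>a \<in> mul u. last_two_adjacent a u \<longleftrightarrow> last_two_adjacent a v)"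

datatype congr_name = TAU1 | GAMMA | LAMBDA | RHO

fun congr :: "congr_name \<Rightarrow> 'a list \<Rightarrow> 'a list \<Rightarrow> bool" where
  "congr TAU1 = tau1"
| "congr GAMMA = gam"
| "congr LAMBDA = lam"
| "congr RHO = rho"

definition word_congr :: "congr_name \<Rightarrow> ('a list \<times> 'a list) set" where
  "word_congr t = {(u, v). congr t u v}"

text \<open>\<open>LetterPlus a\<close> is the formal symbol \<open>a\<^sup>+\<close>.\<close>

datatype 'a symb = Letter 'a | LetterPlus 'a

text \<open>\<open>plus_allowed t a p s\<close> is the side condition under which the displayed occurrence of
  \<open>a\<close> in the word \<open>p @ [Letter a] @ s\<close> may be replaced by \<open>a\<^sup>+\<close>.\<close>

fun plus_allowed :: "congr_name \<Rightarrow> 'a \<Rightarrow> 'a symb list \<Rightarrow> 'a symb list \<Rightarrow> bool" where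
  "plus_allowed TAU1 a p s \<longleftrightarrow> True"
| "plus_allowed GAMMA a p s \<longleftrightarrow> {Letter a, LetterPlus a} \<inter> (set p \<union> set s) \<noteq> {}"
| "plus_allowed LAMBDA a p s \<longleftrightarrow> {Letter a, LetterPlus a} \<inter> set p \<noteq> {}"
| "plus_allowed RHO a p s \<longleftrightarrow> {Letter a, LetterPlus a} \<inter> set s \<noteq> {}"

inductive rewrite_step :: "congr_name \<Rightarrow> 'a symb list \<Rightarrow> 'a symb list \<Rightarrow> bool" for t where
  letter: "plus_allowed t a p s \<Longrightarrow>
    rewrite_step t (p @ [Letter a] @ s) (p @ [LetterPlus a] @ s)"
| plus_plus: "rewrite_step t (p @ [LetterPlus a, LetterPlus a] @ s) (p @ [LetterPlus a] @ s)"
| letter_plus: "rewrite_step t (p @ [Letter a, LetterPlus a] @ s) (p @ [LetterPlus a] @ s)"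
| plus_letter: "rewrite_step t (p @ [LetterPlus a, Letter a] @ s) (p @ [LetterPlus a] @ s)"

definition normal_form :: "congr_name \<Rightarrow> 'a symb list \<Rightarrow> 'a symb list" where
  "normal_form t u = (THE w. (rewrite_step t)\<^sup>*\<^sup>* u w \<and> (\<nexists>w'. rewrite_step t w w'))"

text \<open>All words of a class have the same normal form, which is the value on the class.\<close>

definition canon :: "congr_name \<Rightarrow> 'a list set \<Rightarrow> 'a symb list" where
  "canon t U = the_elem ((\<lambda>u. normal_form t (map Letter u)) ` U)"

text \<open>The product is the class of \<open>u @ v\<close> for any representatives \<open>u\<close>, \<open>v\<close>; the union is over
  equal classes.\<close>

definition word_quotient :: "congr_name \<Rightarrow> 'a list set monoid" where
  "word_quotient t =
    \<lparr> carrier = UNIV // word_congr t,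
      mult = (\<lambda>U V. \<Union>u\<in>U. \<Union>v\<in>V. word_congr t `` {u @ v}),
      one = word_congr t `` {[]} \<rparr>"

definition factor_order :: "('m, 'b) monoid_scheme \<Rightarrow> ('m \<times> 'm) set" where
  "factor_order M = {(v, u). v \<in> carrier M \<and> u \<in> carrier M \<and>
     (\<exists>p \<in> carrier M. \<exists>s \<in> carrier M. u = p \<otimes>\<^bsub>M\<^esub> v \<otimes>\<^bsub>M\<^esub> s)}"

definition factors :: "('m, 'b) monoid_scheme \<Rightarrow> 'm set \<Rightarrow> 'm set" where
  "factors M W = {v. \<exists>u \<in> W. (v, u) \<in> factor_order M}"

definition two_sided_ideal :: "('m, 'b) monoid_scheme \<Rightarrow> 'm \<Rightarrow> 'm set" where
  "two_sided_ideal M x = {p \<otimes>\<^bsub>M\<^esub> x \<otimes>\<^bsub>M\<^esub> s | p s. p \<in> carrier M \<and> s \<in> carrier M}"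

definition green_J :: "('m, 'b) monoid_scheme \<Rightarrow> ('m \<times> 'm) set" where
  "green_J M = {(x, y). x \<in> carrier M \<and> y \<in> carrier M \<and>
     two_sided_ideal M x = two_sided_ideal M y}"

definition J_trivial :: "('m, 'b) monoid_scheme \<Rightarrow> bool" where
  "J_trivial M \<longleftrightarrow> green_J M = Id_on (carrier M)"

text \<open>\<open>None\<close> is the zero. It is always adjoined, even if the ideal is empty, and it is also the
  identity if the ideal is the whole monoid.\<close>

definition rees_quotient :: "('m, 'b) monoid_scheme \<Rightarrow> 'm set \<Rightarrow> 'm option monoid" where
  "rees_quotient M I =
    \<lparr> carrier = insert None (Some ` (carrier M - I)),
      mult = (\<lambda>x y. case (x, y) of
                (Some a, Some b) \<Rightarrow> if a \<otimes>\<^bsub>M\<^esub> b \<in> I then None else Some (a \<otimes>\<^bsub>M\<^esub> b)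
              | _ \<Rightarrow> None),
      one = (if \<one>\<^bsub>M\<^esub> \<in> I then None else Some \<one>\<^bsub>M\<^esub>) \<rparr>"

definition factor_monoid :: "congr_name \<Rightarrow> 'a list set set \<Rightarrow> 'a list set option monoid" where
  "factor_monoid t W =
     rees_quotient (word_quotient t)
       (carrier (word_quotient t) - factors (word_quotient t) W)"

end

(* Each of the four congruences compares the reduced word (adjacent repetitions deleted) together
   with finitely many marks: multiple letters and, for lambda and rho, letters with adjacent first
   or last two occurrences. Passing from v to p v s never shortens the reduced word; if its length
   stays the same, then p and s only repeat the outer letters of v, and this can only add marks.
   Hence mutual factors are equal, and a word has finitely many factor classes, because only
   finitely many reduced words and marks over its letters are available. An idempotent has a
   reduced word of length at most one. *)

theory Submission imports Defs begin

section \<open>Reduced words of factors\<close>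

lemma length_remdups_adj_append_left: "length (remdups_adj v) \<le> length (remdups_adj (p @ v))"
  by (induction p) (auto simp: remdups_adj_Cons split: list.splits)

lemma length_remdups_adj_append_right: "length (remdups_adj v) \<le> length (remdups_adj (v @ s))"
  using length_remdups_adj_append_left[of "rev v" "rev s"]
  by (metis length_rev remdups_adj_rev rev_append)

lemma length_remdups_adj_factor: "length (remdups_adj v) \<le> length (remdups_adj (p @ v @ s))"
  using length_remdups_adj_append_left[of "v @ s" p] length_remdups_adj_append_right[of v s]
  by simp

text \<open>A prepended letter either merges with the letter after it or lengthens the reduced word
  by one. If there is no growth, all letters of \<open>p\<close> merge, so going leftwards each of
  them equals \<open>hd v\<close>.\<close>

lemma length_remdups_adj_append_leD:
  assumes "length (remdups_adj (p @ v)) \<le> length (remdups_adj v)" and "a \<in> set p"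
  shows "v \<noteq> [] \<and> a = hd v"
  using assms
proof (induction p arbitrary: a)
  case (Cons b p)
  have "length (remdups_adj (p @ v)) \<le> length (remdups_adj v)"
    using Cons.prems(1) length_remdups_adj_append_left[of "p @ v" "[b]"] by simp
  then have p: "\<forall>a \<in> set p. v \<noteq> [] \<and> a = hd v"
    using Cons.IH by blast
  have "length (remdups_adj (b # p @ v)) \<le> length (remdups_adj (p @ v))"
    using Cons.prems(1) length_remdups_adj_append_left[of v p] by simp
  then have "p @ v \<noteq> [] \<and> b = hd (p @ v)"
    by (cases "p @ v") (auto split: if_splits)
  then show ?case
    using p Cons.prems(2) by (cases p) auto
qed simp

lemma length_remdups_adj_factorD:
  assumes "length (remdups_adj (p @ v @ s)) \<le> length (remdups_adj v)"
  shows "\<forall>a \<in> set p. v \<noteq> [] \<and> a = hd v" and "\<forall>a \<in> set s. v \<noteq> [] \<and> a = last v"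
proof -
  have "length (remdups_adj (p @ v)) \<le> length (remdups_adj v)"
    using assms length_remdups_adj_append_right[of "p @ v" s] by simp
  then show "\<forall>a \<in> set p. v \<noteq> [] \<and> a = hd v"
    by (intro ballI) (rule length_remdups_adj_append_leD)
  have "length (remdups_adj (v @ s)) \<le> length (remdups_adj v)"
    using assms length_remdups_adj_append_left[of "v @ s" p] by simp
  \<comment> \<open>Reversal turns the suffix \<open>s\<close> into a prefix, and
    \<open>last v\<close> into the head.\<close>
  then have "length (remdups_adj (rev s @ rev v)) \<le> length (remdups_adj (rev v))"
    by (metis length_rev remdups_adj_rev rev_append)
  then show "\<forall>a \<in> set s. v \<noteq> [] \<and> a = last v"
    using length_remdups_adj_append_leD[of "rev s" "rev v"] by (auto simp: hd_rev)
qed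

lemma remdups_adj_append_hd:
  assumes "\<forall>a \<in> set p. v \<noteq> [] \<and> a = hd v"
  shows "remdups_adj (p @ v) = remdups_adj v"
  using assms
proof (induction p)
  case (Cons a p)
  then show ?case
    by (cases "remdups_adj v") (auto simp: remdups_adj_Cons dest: arg_cong[of _ _ hd])
qed simp

lemma remdups_adj_factor_eq:
  assumes "length (remdups_adj (p @ v @ s)) \<le> length (remdups_adj v)"
  shows "remdups_adj (p @ v @ s) = remdups_adj v"
proof -
  note eqs = length_remdups_adj_factorD[OF assms]
  have "remdups_adj (p @ v @ s) = remdups_adj (v @ s)"
    using eqs(1) by (intro remdups_adj_append_hd) auto
  moreover have "remdups_adj (rev s @ rev v) = remdups_adj (rev v)"
    using eqs(2) by (intro remdups_adj_append_hd) (auto simp: hd_rev)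
  ultimately show ?thesis
    by (metis remdups_adj_rev rev_append rev_swap)
qed

text \<open>Reducing either factor beforehand does not affect the reduction of the product, so the
  reduced word is compatible with concatenation.\<close>

lemma remdups_adj_append_cong:
  assumes "remdups_adj u = remdups_adj u'" and "remdups_adj v = remdups_adj v'"
  shows "remdups_adj (u @ v) = remdups_adj (u' @ v')"
proof -
  have right: "remdups_adj (x @ remdups_adj y) = remdups_adj (x @ y)" for x y :: "'a list"
    by (induction x) (auto simp: remdups_adj_Cons distinct_adj_altdef[symmetric])
  have left: "remdups_adj (remdups_adj x @ y) = remdups_adj (x @ y)" for x y :: "'a list"
    using right[of "rev y" "rev x"] by (metis remdups_adj_rev rev_append rev_swap)
  show ?thesis
    using assms left right by metis
qed

section \<open>The congruence \<open>tau1\<close> as equality of reduced words\<close>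

lemma tau1_Cons: "tau1 u v \<Longrightarrow> tau1 (x # u) (x # v)"
  using tau1.cong[OF tau1.refl[of "[x]"]] by fastforce

lemma tau1_remdups_adj: "tau1 u (remdups_adj u)"
proof (induction u rule: remdups_adj.induct)
  case (3 x y xs)
  show ?case
  proof (cases "x = y")
    case True
    have "tau1 (x # x # xs) (x # xs)"
      using tau1.cong[OF tau1.sym[OF tau1.base[of x]] tau1.refl[of xs]] by simp
    then show ?thesis
      using 3 True by (auto intro: tau1.trans)
  qed (use 3 in \<open>auto intro: tau1_Cons\<close>)
qed (auto intro: tau1.refl)

text \<open>The generating pairs have equal reduced words and this survives all closure rules;
  conversely, each word is \<open>tau1\<close>-related to its own reduced word.\<close>

lemma tau1_iff_remdups_adj: "tau1 u v \<longleftrightarrow> remdups_adj u = remdups_adj v"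
proof
  show "remdups_adj u = remdups_adj v" if "tau1 u v"
    using that by induction (auto intro: remdups_adj_append_cong)
  show "tau1 u v" if "remdups_adj u = remdups_adj v"
    using that tau1_remdups_adj by (metis tau1.sym tau1.trans)
qed

section \<open>Multiple letters and adjacency of occurrences\<close>

lemma first_two_adjacent_Nil [simp]: "\<not> first_two_adjacent a []"
  by (simp add: first_two_adjacent_def)

lemma first_two_adjacent_Cons [simp]:
  "first_two_adjacent a (x # u) \<longleftrightarrow>
     (if x = a then u \<noteq> [] \<and> hd u = a else first_two_adjacent a u)"
proof (cases "x = a")
  case True
  have "first_two_adjacent a (x # u)" if "u \<noteq> []" "hd u = a"
    unfolding first_two_adjacent_def using that True
    by (intro exI[of _ "[]"] exI[of _ "tl u"]) (cases u, auto)
  moreover have "u \<noteq> [] \<and> hd u = a" if fta: "first_two_adjacent a (x # u)"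
  proof -
    obtain p s where "x # u = p @ [a, a] @ s" "a \<notin> set p"
      using fta unfolding first_two_adjacent_def by blast
    then show ?thesis using True by (cases p) auto
  qed
  ultimately show ?thesis using True by auto
next
  case False
  have "first_two_adjacent a (x # u)" if "first_two_adjacent a u"
    using that False unfolding first_two_adjacent_def
    by (metis append_Cons set_ConsD)
  moreover have "first_two_adjacent a u" if fta: "first_two_adjacent a (x # u)"
  proof -
    obtain p s where "x # u = p @ [a, a] @ s" "a \<notin> set p"
      using fta unfolding first_two_adjacent_def by blast
    then show ?thesis using False unfolding first_two_adjacent_def by (cases p) auto
  qed
  ultimately show ?thesis using False by auto
qed

text \<open>By this symmetry every fact needed for \<open>RHO\<close> is read off from its
  counterpart for \<open>LAMBDA\<close>.\<close>

lemma last_two_adjacent_conv_rev: "last_two_adjacent a u \<longleftrightarrow> first_two_adjacent a (rev u)"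
proof
  assume "last_two_adjacent a u"
  then obtain p s where "u = p @ [a, a] @ s" "a \<notin> set s"
    unfolding last_two_adjacent_def by blast
  then show "first_two_adjacent a (rev u)"
    unfolding first_two_adjacent_def
    by (intro exI[of _ "rev s"] exI[of _ "rev p"]) auto
next
  assume "first_two_adjacent a (rev u)"
  then obtain p s where "rev u = p @ [a, a] @ s" "a \<notin> set p"
    unfolding first_two_adjacent_def by blast
  then have "u = rev s @ [a, a] @ rev p" "a \<notin> set (rev p)"
    by (auto simp: rev_swap)
  then show "last_two_adjacent a u"
    unfolding last_two_adjacent_def by blast
qed

lemma mul_append: "mul (u @ v) = mul u \<union> mul v \<union> (set u \<inter> set v)"
proof -
  have "2 \<le> count_list u a + count_list v a \<longleftrightarrow>
      2 \<le> count_list u a \<or> 2 \<le> count_list v a \<or> count_list u a \<noteq> 0 \<and> count_list v a \<noteq> 0" for a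
    by arith
  then show ?thesis
    by (auto simp: mul_def count_list_0_iff)
qed

lemma mul_Nil [simp]: "mul [] = {}"
  by (simp add: mul_def)

lemma mul_single [simp]: "mul [a] = {}"
  by (auto simp: mul_def)

lemma mul_Cons: "mul (a # u) = mul u \<union> ({a} \<inter> set u)"
  using mul_append[of "[a]" u] by simp

lemma mul_rev [simp]: "mul (rev u) = mul u"
  by (simp add: mul_def)

lemma mul_subset_set: "mul u \<subseteq> set u"
  by (induction u) (auto simp: mul_Cons)

lemma first_two_adjacent_imp_mul: "first_two_adjacent a u \<Longrightarrow> a \<in> mul u"
  by (induction u) (auto simp: mul_Cons split: if_splits)

lemma first_two_adjacent_imp_set: "first_two_adjacent a u \<Longrightarrow> a \<in> set u"
  using first_two_adjacent_imp_mul mul_subset_set by fastforce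

lemma last_two_adjacent_imp_mul: "last_two_adjacent a u \<Longrightarrow> a \<in> mul u"
  using first_two_adjacent_imp_mul[of a "rev u"] by (simp add: last_two_adjacent_conv_rev)

text \<open>Two occurrences in \<open>u\<close> settle the matter inside \<open>u\<close>. With
  exactly one, the second lies in \<open>v\<close>, and the pair is adjacent only across the
  boundary.\<close>

lemma first_two_adjacent_append:
  "first_two_adjacent a (u @ v) \<longleftrightarrow>
    (if a \<in> set u
     then first_two_adjacent a u \<or> (a \<notin> mul u \<and> last u = a \<and> v \<noteq> [] \<and> hd v = a)
     else first_two_adjacent a v)"
proof (induction u)
  case (Cons x u)
  show ?case
  proof (cases "u = []")
    case False
    then have "last u \<in> set u"
      by simp
    then show ?thesis
      using Cons False by (cases "x = a") (auto simp: mul_Cons)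
  qed (auto simp: mul_Cons)
qed simp

section \<open>The four congruences in a uniform form\<close>

fun marks :: "congr_name \<Rightarrow> 'a list \<Rightarrow> 'a set \<times> 'a set" where
  "marks TAU1 u = ({}, {})"
| "marks GAMMA u = (mul u, {})"
| "marks LAMBDA u = (mul u, {a. first_two_adjacent a u})"
| "marks RHO u = (mul u, {a. last_two_adjacent a u})"

text \<open>\<open>lam\<close> and \<open>rho\<close> compare adjacency for multiple letters only,
  whereas \<open>marks\<close> records it for all letters. The two agree because an adjacent pair
  makes its letter multiple. All later reasoning about \<open>congr\<close> rests on this
  form.\<close>

lemma congr_iff: "congr t u v \<longleftrightarrow> remdups_adj u = remdups_adj v \<and> marks t u = marks t v"
  by (cases t)
    (auto simp: tau1_iff_remdups_adj gam_def lam_def rho_def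
      dest: first_two_adjacent_imp_mul last_two_adjacent_imp_mul)

declare congr.simps [simp del]

lemma congr_refl: "congr t u u"
  by (simp add: congr_iff)

text \<open>Apart from \<open>mul u\<close> and the marks of the factors, the criterion for a
  product uses the letters and last letter of \<open>u\<close> and the head of \<open>v\<close>, all
  of which are visible in the reduced words.\<close>

lemma first_two_adjacent_append_cong:
  assumes "remdups_adj u = remdups_adj u'" "remdups_adj v = remdups_adj v'"
    and "mul u = mul u'"
    and "first_two_adjacent a u = first_two_adjacent a u'"
    and "first_two_adjacent a v = first_two_adjacent a v'"
  shows "first_two_adjacent a (u @ v) = first_two_adjacent a (u' @ v')"
proof -
  have "set u = set u'" "last u = last u'" "hd v = hd v'" "v = [] \<longleftrightarrow> v' = []"
    using assms(1,2) by (metis remdups_adj_set, metis last_remdups_adj, metis hd_remdups_adj,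
        metis remdups_adj_Nil_iff)
  then show ?thesis
    unfolding first_two_adjacent_append using assms(3-5) by simp
qed

lemma mul_append_cong:
  assumes "remdups_adj u = remdups_adj u'" "remdups_adj v = remdups_adj v'"
    and "mul u = mul u'" "mul v = mul v'"
  shows "mul (u @ v) = mul (u' @ v')"
proof -
  have "set u = set u'" "set v = set v'"
    using assms(1,2) by (metis remdups_adj_set)+
  then show ?thesis
    unfolding mul_append using assms(3,4) by simp
qed

lemma congr_append:
  assumes "congr t u u'" "congr t v v'"
  shows "congr t (u @ v) (u' @ v')"
proof -
  have eq: "remdups_adj u = remdups_adj u'" "remdups_adj v = remdups_adj v'"
    "marks t u = marks t u'" "marks t v = marks t v'"
    using assms by (auto simp: congr_iff)
  have rev_eq: "remdups_adj (rev u) = remdups_adj (rev u')" "remdups_adj (rev v) = remdups_adj (rev v')"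
    using eq by simp_all
  have "marks t (u @ v) = marks t (u' @ v')"
  proof (cases t)
    case GAMMA
    then show ?thesis using eq mul_append_cong[of u u' v v'] by simp
  next
    case LAMBDA
    then have fta: "first_two_adjacent a (u @ v) = first_two_adjacent a (u' @ v')" for a
      using eq by (intro first_two_adjacent_append_cong) auto
    have "mul (u @ v) = mul (u' @ v')"
      using LAMBDA eq by (intro mul_append_cong) auto
    then show ?thesis using LAMBDA fta by simp
  next
    case RHO
    \<comment> \<open>Reversal also swaps the factors, so here \<open>mul v = mul v'\<close> serves
      as the condition on the left factor.\<close>
    then have "first_two_adjacent a (rev v @ rev u) = first_two_adjacent a (rev v' @ rev u')" for a
      using eq rev_eq
      by (intro first_two_adjacent_append_cong) (auto simp: last_two_adjacent_conv_rev)
    moreover have "mul (u @ v) = mul (u' @ v')"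
      using RHO eq by (intro mul_append_cong) auto
    ultimately show ?thesis using RHO by (simp add: last_two_adjacent_conv_rev)
  qed simp
  then show ?thesis
    using eq remdups_adj_append_cong by (auto simp: congr_iff)
qed

section \<open>Mutual factors are congruent\<close>

lemma first_two_adjacent_factor:
  assumes "\<forall>a \<in> set p. v \<noteq> [] \<and> a = hd v" and "first_two_adjacent a v"
  shows "first_two_adjacent a (p @ v @ s)"
proof (cases p)
  case (Cons b q)
  then show ?thesis
    \<comment> \<open>A letter other than \<open>hd v\<close> does not occur in \<open>p\<close>.
      For \<open>hd v\<close> itself, the adjacent pair lies in \<open>p\<close> if \<open>p\<close>
      has two letters or more, and straddles the boundary with \<open>v\<close> if \<open>p\<close>
      has one.\<close>
    using assms by (cases q) (auto simp: first_two_adjacent_append dest: first_two_adjacent_imp_set)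
qed (use assms in \<open>auto simp: first_two_adjacent_append dest: first_two_adjacent_imp_set\<close>)

text \<open>The length condition confines \<open>p\<close> and \<open>s\<close> to copies of the
  outer letters of \<open>v\<close>. In general a mark can be lost: \<open>a a\<close> is a factor
  of \<open>a b a a\<close>, where the first two \<open>a\<close> are not adjacent.\<close>

lemma marks_factor:
  assumes "length (remdups_adj (p @ v @ s)) \<le> length (remdups_adj v)"
  shows "fst (marks t v) \<subseteq> fst (marks t (p @ v @ s))"
    and "snd (marks t v) \<subseteq> snd (marks t (p @ v @ s))"
proof -
  note eqs = length_remdups_adj_factorD[OF assms]
  have "mul v \<subseteq> mul (p @ v @ s)"
    by (auto simp: mul_append)
  moreover have "first_two_adjacent a (p @ v @ s)" if "first_two_adjacent a v" for a
    using eqs(1) that by (intro first_two_adjacent_factor) auto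
  moreover have "last_two_adjacent a (p @ v @ s)" if "last_two_adjacent a v" for a
    using eqs(2) that first_two_adjacent_factor[of "rev s" "rev v" a "rev p"]
    by (auto simp: last_two_adjacent_conv_rev hd_rev)
  ultimately show "fst (marks t v) \<subseteq> fst (marks t (p @ v @ s))"
    and "snd (marks t v) \<subseteq> snd (marks t (p @ v @ s))"
    by (cases t; auto)+
qed

lemma congr_factor_antisym:
  assumes uv: "congr t u (p @ v @ s)" and vu: "congr t v (p' @ u @ s')"
  shows "congr t u v"
proof -
  have eq: "remdups_adj u = remdups_adj (p @ v @ s)" "remdups_adj v = remdups_adj (p' @ u @ s')"
    "marks t u = marks t (p @ v @ s)" "marks t v = marks t (p' @ u @ s')"
    using uv vu by (auto simp: congr_iff)
  have le: "length (remdups_adj v) \<le> length (remdups_adj u)"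
    "length (remdups_adj u) \<le> length (remdups_adj v)"
    using length_remdups_adj_factor[of v p s] length_remdups_adj_factor[of u p' s'] eq(1,2)
    by simp_all
  show ?thesis
    using marks_factor[of p v s t] marks_factor[of p' u s' t] remdups_adj_factor_eq[of p v s] eq le
    by (auto simp: congr_iff prod_eq_iff)
qed


section \<open>Rewriting preserves the class of the evaluated word\<close>

text \<open>\<open>expand\<close> evaluates \<open>a\<^sup>+\<close> to \<open>a\<^sup>2\<close>. Rewriting preserves the \<open>t\<close>-class of the evaluation,
  and an irreducible word is recovered from that class; this gives both the uniqueness of normal
  forms and their invariance on classes, without a confluence argument.\<close>

fun base :: "'a symb \<Rightarrow> 'a" where
  "base (Letter a) = a"
| "base (LetterPlus a) = a"

fun expand :: "'a symb list \<Rightarrow> 'a list" where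
  "expand [] = []"
| "expand (Letter a # w) = a # expand w"
| "expand (LetterPlus a # w) = a # a # expand w"

lemma expand_append [simp]: "expand (v @ w) = expand v @ expand w"
  by (induction v rule: expand.induct) auto

lemma expand_map_Letter [simp]: "expand (map Letter u) = u"
  by (induction u) auto

lemma set_expand [simp]: "set (expand w) = base ` set w"
  by (induction w rule: expand.induct) auto

lemma expand_eq_Nil_iff [simp]: "expand w = [] \<longleftrightarrow> w = []"
  by (cases w rule: expand.cases) auto

lemma hd_expand: "w \<noteq> [] \<Longrightarrow> hd (expand w) = base (hd w)"
  by (cases w rule: expand.cases) auto

lemma last_expand: "w \<noteq> [] \<Longrightarrow> last (expand w) = base (last w)"
  by (induction w rule: expand.induct) auto

lemma remdups_adj_expand: "remdups_adj (expand w) = remdups_adj (map base w)"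
  by (induction w rule: expand.induct) (auto simp: remdups_adj_Cons split: list.splits)

text \<open>Both symbols over \<open>a\<close> evaluate to words containing \<open>a\<close>, so the
  side condition can be tested on evaluated words.\<close>

lemma plus_allowed_iff_expand:
  "plus_allowed t a p s \<longleftrightarrow>
    (case t of TAU1 \<Rightarrow> True
     | GAMMA \<Rightarrow> a \<in> set (expand p) \<union> set (expand s)
     | LAMBDA \<Rightarrow> a \<in> set (expand p)
     | RHO \<Rightarrow> a \<in> set (expand s))"
proof -
  have base_eq: "base x = a \<longleftrightarrow> x = Letter a \<or> x = LetterPlus a" for x
    by (cases x) auto
  have "a \<in> base ` X \<longleftrightarrow> {Letter a, LetterPlus a} \<inter> X \<noteq> {}" for X
  proof -
    have "a \<in> base ` X \<longleftrightarrow> (\<exists>x \<in> X. base x = a)"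
      by auto
    then show ?thesis
      unfolding base_eq by blast
  qed
  then show ?thesis
    by (cases t) (simp_all add: image_Un[symmetric] del: image_Un)
qed

lemma first_two_adjacent_double_letter:
  assumes "a \<in> set p"
  shows "first_two_adjacent b (p @ a # a # s) = first_two_adjacent b (p @ a # s)"
  using assms by (auto simp: first_two_adjacent_append)

text \<open>The side condition is what keeps the marks fixed. For \<open>GAMMA\<close> the letter is
  already multiple; for \<open>LAMBDA\<close> an earlier \<open>a\<close> exists, so the extra copy
  comes after the first two occurrences; \<open>RHO\<close> is dual.\<close>

lemma congr_double_letter:
  assumes "plus_allowed t a p s"
  shows "congr t (expand p @ a # a # expand s) (expand p @ a # expand s)"
proof -
  have "remdups_adj (expand p @ a # a # expand s) = remdups_adj (expand p @ a # expand s)"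
    by (rule remdups_adj_append_cong) auto
  moreover have "mul (expand p @ a # a # expand s) = mul (expand p @ a # expand s)" if "t \<noteq> TAU1"
    using assms that
    by (cases t) (auto simp: mul_append mul_Cons plus_allowed_iff_expand simp del: set_expand)
  moreover have "first_two_adjacent b (expand p @ a # a # expand s) =
      first_two_adjacent b (expand p @ a # expand s)" if "t = LAMBDA" for b
    using assms that
    by (intro first_two_adjacent_double_letter) (simp add: plus_allowed_iff_expand)
  moreover have "last_two_adjacent b (expand p @ a # a # expand s) =
      last_two_adjacent b (expand p @ a # expand s)" if "t = RHO" for b
    using assms that first_two_adjacent_double_letter[of a "rev (expand s)" b "rev (expand p)"]
    by (simp add: last_two_adjacent_conv_rev plus_allowed_iff_expand)
  ultimately show ?thesis
    by (cases t) (auto simp: congr_iff)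
qed

text \<open>The words \<open>a a a\<close> and \<open>a a a a\<close> evaluate the left sides of the
  absorbing rules. They are congruent to \<open>a a\<close> because two adjacent copies already
  carry every mark possible on one letter.\<close>

lemma congr_plus_absorb: "congr t [a, a, a] [a, a]" "congr t [a, a, a, a] [a, a]"
  unfolding congr_iff
  by (cases t; simp add: mul_Cons last_two_adjacent_conv_rev)+

lemma congr_context: "congr t u v \<Longrightarrow> congr t (p @ u @ s) (p @ v @ s)"
  using congr_append congr_refl by blast

lemma rewrite_step_congr: "rewrite_step t v w \<Longrightarrow> congr t (expand w) (expand v)"
proof (induction rule: rewrite_step.induct)
  case (letter a p s)
  then show ?case
    using congr_double_letter by simp
next
  case (plus_plus p a s)
  then show ?case
    using congr_context[OF congr_plus_absorb(2)[of t a], of "expand p" "expand s"]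
    by (simp add: congr_iff)
next
  case (letter_plus p a s)
  then show ?case
    using congr_context[OF congr_plus_absorb(1)[of t a], of "expand p" "expand s"]
    by (simp add: congr_iff)
next
  case (plus_letter p a s)
  then show ?case
    using congr_context[OF congr_plus_absorb(1)[of t a], of "expand p" "expand s"]
    by (simp add: congr_iff)
qed

lemma rewrite_steps_congr: "(rewrite_step t)\<^sup>*\<^sup>* v w \<Longrightarrow> congr t (expand w) (expand v)"
  by (induction rule: rtranclp_induct)
    (auto simp: congr_iff dest: rewrite_step_congr)

section \<open>Irreducible words: existence and uniqueness\<close>

definition irreducible_word :: "congr_name \<Rightarrow> 'a symb list \<Rightarrow> bool" where
  "irreducible_word t w \<longleftrightarrow> (\<nexists>w'. rewrite_step t w w')"

lemma irreducible_word_exists: "\<exists>w. (rewrite_step t)\<^sup>*\<^sup>* v w \<and> irreducible_word t w"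
\<comment> \<open>Termination measure: the letter rule keeps the length and removes one plain
  letter; the other rules shorten the word and create no plain letter.\<close>
proof (induction "length v + length (filter (\<lambda>x. x = Letter (base x)) v)" arbitrary: v rule: less_induct)
  case less
  show ?case
  proof (cases "irreducible_word t v")
    case False
    then obtain v' where step: "rewrite_step t v v'"
      unfolding irreducible_word_def by blast
    then have "length v' + length (filter (\<lambda>x. x = Letter (base x)) v')
        < length v + length (filter (\<lambda>x. x = Letter (base x)) v)"
      by cases auto
    then show ?thesis
      using less step by (meson converse_rtranclp_into_rtranclp)
  qed auto
qed

lemma irreducible_word_not_plus_allowed:
  "irreducible_word t (p @ Letter a # s) \<Longrightarrow> \<not> plus_allowed t a p s"
  unfolding irreducible_word_def using rewrite_step.letter[of t a p s] by auto

text \<open>Neighbours over the same letter always admit a step. If one of them is a plus symbol, an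
  absorbing rule applies; of two plain letters, each supplies the occurrence of \<open>a\<close>
  that the side condition for the other asks for, on the left or on the right.\<close>

lemma irreducible_word_distinct_adj:
  assumes irr: "irreducible_word t w"
  shows "distinct_adj (map base w)"
proof -
  have "base x \<noteq> base y" if w: "w = p @ x # y # s" for p x y s
  proof
    assume eq: "base x = base y"
    show False
    proof (cases x)
      case (Letter a)
      show False
      proof (cases y)
        case (Letter b)
        have "\<not> plus_allowed t a p (y # s)" "\<not> plus_allowed t b (p @ [x]) s"
          using irr w \<open>x = Letter a\<close> \<open>y = Letter b\<close>
          by (auto intro!: irreducible_word_not_plus_allowed)
        then show False
          using eq \<open>x = Letter a\<close> \<open>y = Letter b\<close> by (cases t) auto
      next
        case (LetterPlus b)
        then show False
          using irr eq w Letter rewrite_step.letter_plus[of t p a s]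
          by (auto simp: irreducible_word_def)
      qed
    next
      case (LetterPlus a)
      then show False
        using irr eq w rewrite_step.plus_plus[of t p a s] rewrite_step.plus_letter[of t p a s]
        by (cases y) (auto simp: irreducible_word_def)
    qed
  qed
  then show ?thesis
    unfolding distinct_adj_conv_nth
    by (metis (no_types, lifting) Cons_nth_drop_Suc Suc_lessD id_take_nth_drop length_map nth_map)
qed

text \<open>Decides which symbol over \<open>a\<close> stands at a position of an irreducible word
  from data of the class alone: \<open>p\<close> and \<open>s\<close> are the base letters before
  and after the position, and \<open>m\<close> is the pair of marks.\<close>

fun plus_required :: "congr_name \<Rightarrow> 'a list \<Rightarrow> 'a list \<Rightarrow> 'a set \<times> 'a set \<Rightarrow> 'a \<Rightarrow> bool" where
  "plus_required TAU1 p s m a \<longleftrightarrow> True"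
| "plus_required GAMMA p s m a \<longleftrightarrow> a \<in> fst m"
| "plus_required LAMBDA p s m a \<longleftrightarrow> a \<in> set p \<or> a \<in> snd m"
| "plus_required RHO p s m a \<longleftrightarrow> a \<in> set s \<or> a \<in> snd m"

text \<open>A plus symbol contributes \<open>a a\<close> and so forces the condition. At a plain
  letter the side condition fails and the neighbours have other base letters, so no adjacent pair
  can start or end there.\<close>

lemma irreducible_word_symbol:
  assumes irr: "irreducible_word t (p @ x # s)"
  shows "x = (if plus_required t (map base p) (map base s) (marks t (expand (p @ x # s))) (base x)
              then LetterPlus (base x) else Letter (base x))"
proof (cases x)
  case (Letter a)
  have adj: "distinct_adj (map base (p @ x # s))"
    using irr by (rule irreducible_word_distinct_adj)
  have no: "\<not> plus_allowed t a p s"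
    using irr unfolding Letter by (rule irreducible_word_not_plus_allowed)
  have after: "s = [] \<or> hd (expand s) \<noteq> a"
    using adj Letter by (cases s) (auto simp: hd_expand distinct_adj_append_iff)
  have before: "p = [] \<or> hd (rev (expand p)) \<noteq> a"
    using adj Letter by (cases p rule: rev_cases) (auto simp: hd_rev last_expand distinct_adj_append_iff)
  have "\<not> plus_required t (map base p) (map base s) (marks t (expand (p @ x # s))) a"
  proof (cases t)
    case TAU1
    then show ?thesis using no by simp
  next
    case GAMMA
    then have "a \<notin> set (expand p)" "a \<notin> set (expand s)"
      using no by (auto simp: plus_allowed_iff_expand)
    then show ?thesis
      using GAMMA Letter mul_subset_set by (fastforce simp: mul_append mul_Cons)
  next
    case LAMBDA
    then have "a \<notin> set (expand p)"
      using no by (auto simp: plus_allowed_iff_expand)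
    then show ?thesis
      using LAMBDA Letter after by (auto simp: first_two_adjacent_append)
  next
    case RHO
    then have "a \<notin> set (expand s)"
      using no by (auto simp: plus_allowed_iff_expand)
    then show ?thesis
      using RHO Letter before by (auto simp: last_two_adjacent_conv_rev first_two_adjacent_append)
  qed
  then show ?thesis
    using Letter by simp
next
  case (LetterPlus a)
  then have "plus_required t (map base p) (map base s) (marks t (expand (p @ x # s))) a"
    by (cases t)
      (auto simp: mul_append mul_Cons last_two_adjacent_conv_rev first_two_adjacent_append)
  then show ?thesis
    using LetterPlus by simp
qed

lemma map_base_irreducible_word:
  "irreducible_word t w \<Longrightarrow> map base w = remdups_adj (expand w)"
  by (drule irreducible_word_distinct_adj) (simp add: remdups_adj_expand distinct_adj_altdef)

text \<open>The class fixes the reduced word, which is the word of base letters, and the marks;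
  these determine the symbol at each position.\<close>

lemma irreducible_word_unique:
  assumes irr: "irreducible_word t v" "irreducible_word t w"
    and congr: "congr t (expand v) (expand w)"
  shows "v = w"
proof -
  have base: "map base v = map base w"
    using irr congr by (simp add: map_base_irreducible_word congr_iff)
  have marks: "marks t (expand v) = marks t (expand w)"
    using congr by (simp add: congr_iff)
  show ?thesis
  proof (rule nth_equalityI)
    show len: "length v = length w"
      using base by (rule map_eq_imp_length_eq)
    fix i assume i: "i < length v"
    have split: "v = take i v @ v ! i # drop (Suc i) v" "w = take i w @ w ! i # drop (Suc i) w"
      using i len by (simp_all add: id_take_nth_drop)
    have same: "map base (take i v) = map base (take i w)"
      "map base (drop (Suc i) v) = map base (drop (Suc i) w)" "base (v ! i) = base (w ! i)"
      using base i len by (simp_all add: take_map[symmetric] drop_map[symmetric])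
        (metis nth_map)
    show "v ! i = w ! i"
      using irreducible_word_symbol[of t "take i v" "v ! i" "drop (Suc i) v"]
        irreducible_word_symbol[of t "take i w" "w ! i" "drop (Suc i) w"]
        irr marks same
      by (simp only: split[symmetric])
  qed
qed

text \<open>Reachability of \<open>w\<close> is a consequence: some irreducible \<open>v\<close> is
  reachable, its evaluation is congruent to \<open>u\<close>, and uniqueness gives
  \<open>v = w\<close>.\<close>

lemma normal_form_eqI:
  assumes "irreducible_word t w" and "congr t (expand w) u"
  shows "normal_form t (map Letter u) = w"
proof -
  have unique: "v = w" if "(rewrite_step t)\<^sup>*\<^sup>* (map Letter u) v" "irreducible_word t v" for v
    using rewrite_steps_congr[OF that(1)] that(2) assms
    by (intro irreducible_word_unique) (auto simp: congr_iff)
  obtain v where "(rewrite_step t)\<^sup>*\<^sup>* (map Letter u) v" "irreducible_word t v"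
    using irreducible_word_exists by blast
  then show ?thesis
    unfolding normal_form_def irreducible_word_def[symmetric]
    using unique by (metis (mono_tags, lifting) the_equality)
qed

section \<open>The quotient monoid, canonical forms and idempotents\<close>

abbreviation word_class :: "congr_name \<Rightarrow> 'a list \<Rightarrow> 'a list set" where
  "word_class t u \<equiv> word_congr t `` {u}"

lemma equiv_word_congr: "equiv UNIV (word_congr t)"
  by (intro equivI refl_onI symI transI) (auto simp: word_congr_def congr_iff)

lemma word_class_eq_iff: "word_class t u = word_class t v \<longleftrightarrow> congr t u v"
  using eq_equiv_class_iff[OF equiv_word_congr] by (auto simp: word_congr_def)

text \<open>The same \<open>w\<close> is the normal form of every representative, so
  \<open>the_elem\<close> is applied to a singleton.\<close>

lemma canon_word_class:
  assumes "irreducible_word t w" and "congr t (expand w) u"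
  shows "canon t (word_class t u) = w"
proof -
  have "(\<lambda>u. normal_form t (map Letter u)) ` word_class t u = {w}"
    using normal_form_eqI[OF assms(1)] assms(2)
    by (force simp: word_congr_def congr_iff)
  then show ?thesis
    by (simp add: canon_def)
qed

lemma carrier_word_quotient: "carrier (word_quotient t) = range (word_class t)"
  by (auto simp: word_quotient_def quotient_def)

lemma mult_word_quotient:
  "word_class t u \<otimes>\<^bsub>word_quotient t\<^esub> word_class t v = word_class t (u @ v)"
proof -
  have mem: "u \<in> word_class t u" "v \<in> word_class t v"
    by (auto simp: word_congr_def congr_refl)
  have const: "word_class t (u' @ v') = word_class t (u @ v)"
    if "u' \<in> word_class t u" "v' \<in> word_class t v" for u' v'
  proof -
    have "congr t u u'" "congr t v v'"
      using that by (auto simp: word_congr_def)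
    then show ?thesis
      unfolding word_class_eq_iff using congr_append[of t u u' v v'] by (simp add: congr_iff)
  qed
  have "(\<Union>v' \<in> word_class t v. word_class t (u' @ v')) = word_class t (u @ v)"
    if "u' \<in> word_class t u" for u'
    using mem(2) const[OF that] by (intro UN_constant_eq) auto
  then have "(\<Union>u' \<in> word_class t u. \<Union>v' \<in> word_class t v. word_class t (u' @ v')) =
      word_class t (u @ v)"
    using mem(1) by (intro UN_constant_eq) auto
  then show ?thesis
    by (simp add: word_quotient_def)
qed

lemma one_word_quotient: "\<one>\<^bsub>word_quotient t\<^esub> = word_class t []"
  by (simp add: word_quotient_def)

lemma monoid_word_quotient: "monoid (word_quotient t)"
  by (intro monoidI)
    (auto simp: carrier_word_quotient one_word_quotient mult_word_quotient)

lemma factor_order_word_quotient: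
  "(word_class t v, word_class t u) \<in> factor_order (word_quotient t) \<longleftrightarrow>
    (\<exists>p s. congr t u (p @ v @ s))"
  by (auto simp: factor_order_def carrier_word_quotient mult_word_quotient word_class_eq_iff)

lemma antisym_factor_order_word_quotient: "antisym (factor_order (word_quotient t))"
proof (rule antisymI)
  fix V U :: "'a list set"
  assume vu: "(V, U) \<in> factor_order (word_quotient t)" and uv: "(U, V) \<in> factor_order (word_quotient t)"
  then obtain u v where "V = word_class t v" "U = word_class t u"
    by (auto simp: factor_order_def carrier_word_quotient)
  then show "V = U"
    using vu uv congr_factor_antisym[of t v _ u]
    by (auto simp: factor_order_word_quotient word_class_eq_iff)
qed

lemma idempotent_word_quotient_iff:
  assumes "U \<in> carrier (word_quotient t)"
  shows "U \<otimes>\<^bsub>word_quotient t\<^esub> U = U \<longleftrightarrow> canon t U = [] \<or> (\<exists>x. canon t U = [LetterPlus x])"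
proof -
  obtain u where u: "U = word_class t u"
    using assms by (auto simp: carrier_word_quotient)
  obtain w where steps: "(rewrite_step t)\<^sup>*\<^sup>* (map Letter u) w" and irr: "irreducible_word t w"
    using irreducible_word_exists by blast
  have "congr t (expand w) u"
    using rewrite_steps_congr[OF steps] by simp
  \<comment> \<open>The evaluated normal form serves as representative of \<open>U\<close> from here
    on.\<close>
  then have canon: "canon t U = w" and U: "U = word_class t (expand w)"
    using canon_word_class[OF irr] u by (auto simp: word_class_eq_iff congr_iff)
  have "congr t (expand w @ expand w) (expand w) \<longleftrightarrow> w = [] \<or> (\<exists>x. w = [LetterPlus x])"
  proof
    assume idem: "congr t (expand w @ expand w) (expand w)"
    show "w = [] \<or> (\<exists>x. w = [LetterPlus x])"
    proof (cases w)
      case (Cons y v)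
      \<comment> \<open>The first copy is treated as a prefix of the second, with empty suffix;
        hence all its letters equal the head.\<close>
      have "length (remdups_adj (expand w @ expand w @ [])) \<le> length (remdups_adj (expand w))"
        using idem by (simp add: congr_iff)
      then have "\<forall>a \<in> set (expand w). a = base y"
        using length_remdups_adj_factorD(1) Cons hd_expand[of w] by fastforce
      then have "\<forall>b \<in> set w. base b = base y"
        by simp
      then have "v = []"
        using irreducible_word_distinct_adj[OF irr] Cons by (cases v) auto
      moreover have "y = LetterPlus (base y)"
      proof (cases y)
        case (Letter a)
        \<comment> \<open>A single plain letter is impossible: \<open>TAU1\<close> would allow a
          step, and in the other cases \<open>a\<close> is multiple in \<open>a a\<close> but not in
          \<open>a\<close>.\<close>
        then have "\<not> plus_allowed t a [] []" "congr t [a, a] [a]"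
          using irr Cons \<open>v = []\<close> idem irreducible_word_not_plus_allowed[of t "[]" a "[]"] by auto
        then show ?thesis
          by (cases t) (auto simp: congr_iff mul_Cons)
      qed simp
      ultimately show ?thesis
        using Cons by blast
    qed simp
  next
    assume "w = [] \<or> (\<exists>x. w = [LetterPlus x])"
    then show "congr t (expand w @ expand w) (expand w)"
      using congr_plus_absorb(2) congr_refl by auto
  qed
  then show ?thesis
    using canon U by (simp add: mult_word_quotient word_class_eq_iff)
qed

section \<open>Finiteness of the set of factors\<close>

lemma finite_word_classes:
  assumes "finite A"
  shows "finite (word_class t ` {u. set u \<subseteq> A \<and> length (remdups_adj u) \<le> n})"
proof -
  let ?words = "{u. set u \<subseteq> A \<and> length (remdups_adj u) \<le> n}"
  let ?key = "\<lambda>u. (remdups_adj u, marks t u)"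
  have "marks t u \<in> Pow A \<times> Pow A" if "set u \<subseteq> A" for u
    using that mul_subset_set[of u]
    by (cases t) (auto dest: first_two_adjacent_imp_mul last_two_adjacent_imp_mul)
  then have "?key ` ?words \<subseteq> {xs. set xs \<subseteq> A \<and> length xs \<le> n} \<times> (Pow A \<times> Pow A)"
    by (intro image_subsetI SigmaI) simp_all
  then have "finite (?key ` ?words)"
    using assms by (rule_tac finite_subset) (auto intro: finite_lists_length_le)
  \<comment> \<open>The class map factors through the key: any word chosen with the same key lies in
    the same class.\<close>
  moreover have "word_class t ` ?words \<subseteq> (\<lambda>k. word_class t (SOME u. ?key u = k)) ` (?key ` ?words)"
  proof
    fix U assume "U \<in> word_class t ` ?words"
    then obtain u where u: "u \<in> ?words" "U = word_class t u"
      by blast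
    have "?key (SOME v. ?key v = ?key u) = ?key u"
      by (rule someI[where x = u]) simp
    then have "U = word_class t (SOME v. ?key v = ?key u)"
      using u by (auto simp: word_class_eq_iff congr_iff)
    then show "U \<in> (\<lambda>k. word_class t (SOME u. ?key u = k)) ` (?key ` ?words)"
      using u by blast
  qed
  ultimately show ?thesis
    by (meson finite_imageI finite_subset)
qed

lemma finite_factors_word_quotient:
  assumes "finite W"
  shows "finite (factors (word_quotient t) W)"
proof -
  have "finite {V. (V, U) \<in> factor_order (word_quotient t)}" for U :: "'a list set"
  proof (cases "U \<in> carrier (word_quotient t)")
    case True
    then obtain u where u: "U = word_class t u"
      by (auto simp: carrier_word_quotient)
    have "{V. (V, U) \<in> factor_order (word_quotient t)} \<subseteq>
        word_class t ` {v. set v \<subseteq> set u \<and> length (remdups_adj v) \<le> length (remdups_adj u)}"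
    proof
      fix V assume "V \<in> {V. (V, U) \<in> factor_order (word_quotient t)}"
      then have fac: "(V, U) \<in> factor_order (word_quotient t)"
        by simp
      then obtain v where v: "V = word_class t v"
        by (auto simp: factor_order_def carrier_word_quotient)
      then obtain p s where "congr t u (p @ v @ s)"
        using fac u factor_order_word_quotient by blast
      then have rd: "remdups_adj u = remdups_adj (p @ v @ s)"
        by (simp add: congr_iff)
      then have "set u = set (p @ v @ s)"
        by (metis remdups_adj_set)
      moreover have "length (remdups_adj v) \<le> length (remdups_adj u)"
        unfolding rd by (rule length_remdups_adj_factor)
      ultimately show "V \<in> word_class t `
          {v. set v \<subseteq> set u \<and> length (remdups_adj v) \<le> length (remdups_adj u)}"
        using v by auto
    qed
    then show ?thesis
      by (rule finite_subset) (rule finite_word_classes, simp)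
  qed (simp add: factor_order_def)
  then have "finite (\<Union>U \<in> W. {V. (V, U) \<in> factor_order (word_quotient t)})"
    using assms by blast
  then show ?thesis
    by (rule rev_finite_subset) (auto simp: factors_def)
qed

section \<open>Factor order and Rees quotients of arbitrary monoids\<close>

context monoid
begin

lemma refl_on_factor_order: "refl_on (carrier G) (factor_order G)"
proof (rule refl_onI)
  fix x assume "x \<in> carrier G"
  moreover from this have "x = \<one> \<otimes> x \<otimes> \<one>"
    by simp
  ultimately show "(x, x) \<in> factor_order G"
    unfolding factor_order_def by blast
qed

lemma trans_factor_order: "trans (factor_order G)"
proof (rule transI)
  fix x y z
  assume "(x, y) \<in> factor_order G" "(y, z) \<in> factor_order G"
  then obtain p s p' s' where eqs: "y = p \<otimes> x \<otimes> s" "z = p' \<otimes> y \<otimes> s'"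
    and carr: "x \<in> carrier G" "z \<in> carrier G" "p \<in> carrier G" "s \<in> carrier G"
      "p' \<in> carrier G" "s' \<in> carrier G"
    by (auto simp: factor_order_def)
  have "z = (p' \<otimes> p) \<otimes> x \<otimes> (s \<otimes> s')"
    using eqs carr by (simp add: m_assoc)
  then show "(x, z) \<in> factor_order G"
    using carr unfolding factor_order_def by blast
qed

text \<open>Equal principal ideals contain each other's generators, which makes the generators
  mutual factors.\<close>

lemma J_trivial_if_antisym_factor_order:
  assumes "antisym (factor_order G)"
  shows "J_trivial G"
proof -
  have "x = y" if "(x, y) \<in> green_J G" for x y
  proof -
    have carr: "x \<in> carrier G" "y \<in> carrier G" and ideal: "two_sided_ideal G x = two_sided_ideal G y"
      using that by (auto simp: green_J_def)
    have "z \<in> two_sided_ideal G z" if "z \<in> carrier G" for z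
      using refl_onD[OF refl_on_factor_order that]
      by (auto simp: factor_order_def two_sided_ideal_def)
    then have "x \<in> two_sided_ideal G y" "y \<in> two_sided_ideal G x"
      using ideal carr by blast+
    then have "(y, x) \<in> factor_order G" "(x, y) \<in> factor_order G"
      using carr by (auto simp: factor_order_def two_sided_ideal_def)
    then show "x = y"
      using assms by (auto dest: antisymD)
  qed
  then show ?thesis
    by (auto simp: J_trivial_def Id_on_def green_J_def)
qed

lemma partial_order_factor_order:
  "antisym (factor_order G) \<Longrightarrow> partial_order_on (carrier G) (factor_order G)"
  using refl_on_factor_order trans_factor_order
  by (auto simp: partial_order_on_def preorder_on_def factor_order_def)

text \<open>The set of factors is closed downwards by transitivity, so its complement is an
  ideal.\<close>

lemma non_factors_absorb:
  assumes "a \<in> carrier G" "x \<in> carrier G - factors G W"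
  shows "a \<otimes> x \<in> carrier G - factors G W" "x \<otimes> a \<in> carrier G - factors G W"
proof -
  have carr: "x \<in> carrier G"
    using assms by simp
  have "a \<otimes> x = a \<otimes> x \<otimes> \<one>" "x \<otimes> a = \<one> \<otimes> x \<otimes> a"
    using assms carr by auto
  then have "(x, a \<otimes> x) \<in> factor_order G" "(x, x \<otimes> a) \<in> factor_order G"
    unfolding factor_order_def using assms(1) carr by blast+
  then show "a \<otimes> x \<in> carrier G - factors G W" "x \<otimes> a \<in> carrier G - factors G W"
    using assms transD[OF trans_factor_order] by (auto simp: factors_def)
qed

lemma monoid_rees_quotient:
  assumes left: "\<And>a x. a \<in> carrier G \<Longrightarrow> x \<in> I \<Longrightarrow> a \<otimes> x \<in> I"
    and right: "\<And>a x. a \<in> carrier G \<Longrightarrow> x \<in> I \<Longrightarrow> x \<otimes> a \<in> I"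
  shows "monoid (rees_quotient G I)"
proof (rule monoidI)
  \<comment> \<open>An ideal containing the identity is everything; then \<open>None\<close> is the
    only element and acts as identity.\<close>
  have "a \<in> I" if "\<one> \<in> I" "a \<in> carrier G" for a
    using left[OF that(2,1)] that(2) by simp
  then show "\<one>\<^bsub>rees_quotient G I\<^esub> \<otimes>\<^bsub>rees_quotient G I\<^esub> x = x" if "x \<in> carrier (rees_quotient G I)" for x
    using that by (auto simp: rees_quotient_def)
  show "x \<otimes>\<^bsub>rees_quotient G I\<^esub> \<one>\<^bsub>rees_quotient G I\<^esub> = x" if "x \<in> carrier (rees_quotient G I)" for x
    using that \<open>\<And>a. \<one> \<in> I \<Longrightarrow> a \<in> carrier G \<Longrightarrow> a \<in> I\<close> by (auto simp: rees_quotient_def)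
next
  fix x y z
  assume "x \<in> carrier (rees_quotient G I)" "y \<in> carrier (rees_quotient G I)"
    "z \<in> carrier (rees_quotient G I)"
  \<comment> \<open>Both bracketings of a product vanish together.\<close>
  moreover have "a \<otimes> (b \<otimes> c) \<in> I"
    if "a \<otimes> b \<in> I" "a \<in> carrier G" "b \<in> carrier G" "c \<in> carrier G" for a b c
    using right[OF that(4,1)] that by (simp add: m_assoc)
  ultimately show "x \<otimes>\<^bsub>rees_quotient G I\<^esub> y \<otimes>\<^bsub>rees_quotient G I\<^esub> z =
      x \<otimes>\<^bsub>rees_quotient G I\<^esub> (y \<otimes>\<^bsub>rees_quotient G I\<^esub> z)"
    by (auto simp: rees_quotient_def m_assoc intro: left)
qed (auto simp: rees_quotient_def split: if_splits)

lemma antisym_factor_order_rees_quotient: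
  assumes "antisym (factor_order G)"
  shows "antisym (factor_order (rees_quotient G I))"
proof (rule antisymI)
  \<comment> \<open>Zero is a factor of zero only, so a nonzero \<open>y\<close> forces
    \<open>x\<close> and both multipliers to be nonzero, and the factorization already holds in
    \<open>G\<close>.\<close>
  have lift: "\<exists>a b. x = Some a \<and> y = Some b \<and> (a, b) \<in> factor_order G"
    if xy: "(x, y) \<in> factor_order (rees_quotient G I)" and "y \<noteq> None" for x y
  proof -
    obtain p s where "p \<in> carrier (rees_quotient G I)" "s \<in> carrier (rees_quotient G I)"
      "x \<in> carrier (rees_quotient G I)" "y \<in> carrier (rees_quotient G I)"
      "y = p \<otimes>\<^bsub>rees_quotient G I\<^esub> x \<otimes>\<^bsub>rees_quotient G I\<^esub> s"
      using xy by (auto simp: factor_order_def)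
    then show ?thesis
      using \<open>y \<noteq> None\<close>
      by (auto simp: rees_quotient_def factor_order_def split: option.splits if_splits)
  qed
  fix x y
  assume xy: "(x, y) \<in> factor_order (rees_quotient G I)" "(y, x) \<in> factor_order (rees_quotient G I)"
  show "x = y"
  proof (cases "x = None \<and> y = None")
    case False
    then obtain a b where "x = Some a" "y = Some b" "(a, b) \<in> factor_order G" "(b, a) \<in> factor_order G"
      using lift[OF xy(1)] lift[OF xy(2)] by blast
    then show ?thesis
      using assms by (auto dest: antisymD)
  qed simp
qed

end

lemma finite_carrier_factor_monoid:
  assumes "finite W"
  shows "finite (carrier (factor_monoid t W))"
  \<comment> \<open>Taking the complement of the ideal again leaves only classes that are factors,
    besides the zero.\<close>
  using finite_factors_word_quotient[OF assms, of t]
  by (auto simp: factor_monoid_def rees_quotient_def Diff_Diff_Int)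

theorem proposition8p5:
  fixes t :: congr_name
  assumes "countable (UNIV :: 'a set)" and "infinite (UNIV :: 'a set)"
  shows
    "(\<forall>U \<in> carrier (word_quotient t :: 'a list set monoid).
        U \<otimes>\<^bsub>word_quotient t\<^esub> U = U \<longleftrightarrow>
          (canon t U = [] \<or> (\<exists>x. canon t U = [LetterPlus x]))) \<and>
     (partial_order_on (carrier (word_quotient t :: 'a list set monoid))
        (factor_order (word_quotient t)) \<and>
      monoid (word_quotient t :: 'a list set monoid) \<and>
      J_trivial (word_quotient t :: 'a list set monoid)) \<and>
     (\<forall>W \<subseteq> carrier (word_quotient t :: 'a list set monoid). finite W \<longrightarrow>
        monoid (factor_monoid t W) \<and> finite (carrier (factor_monoid t W)) \<and>
        J_trivial (factor_monoid t W))"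
proof -
  let ?Q = "word_quotient t :: 'a list set monoid"
  interpret Q: monoid ?Q
    by (rule monoid_word_quotient)
  note antisym = antisym_factor_order_word_quotient[of t, where 'a = 'a]
  have "monoid (factor_monoid t W)" for W :: "'a list set set"
    unfolding factor_monoid_def using Q.non_factors_absorb by (intro Q.monoid_rees_quotient)
  moreover from this have "J_trivial (factor_monoid t W)" for W :: "'a list set set"
    unfolding factor_monoid_def
    by (intro monoid.J_trivial_if_antisym_factor_order Q.antisym_factor_order_rees_quotient antisym)
  ultimately show ?thesis
    using idempotent_word_quotient_iff Q.partial_order_factor_order[OF antisym]
      Q.J_trivial_if_antisym_factor_order[OF antisym] Q.monoid_axioms finite_carrier_factor_monoid
    by blast
qed

end
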